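(* Consider an instance of the Capacitated Delivery Problem with Parking (CDPP) with loading times $f_j=f\cdot|\sigma_j|$ for some constant $f\ge0$. For $i\in\Pi\cap C$, let $\sigma_{j_i}=\{i\}$. There exists an optimal solution of the CDPP where $y_{ij_i}=1$ for each $i\in\Pi\cap C$ at which the vehicle parks (i.e. such that $x_{ki}=1$ for some $k\in\Pi\setminus\{i\}$); that is, $$\sum_{k\in\Pi\setminus\{i\}}x_{ki}=y_{ij_i}\qquad\text{for all } i\in\Pi\cap C.$$
   Context: CDPP data. $C$ is a finite set of $n\ge1$ customers, each requiring one package. $\Pi$ is a finite set consisting of the depot $0$ (with $0\notin C$) and the parking locations $\Pi\setminus\{0\}\neq\emptyset$; parking locations may or may not be customers. $p_i\ge0$ is the search time for parking at $i\in\Pi\setminus\{0\}$. $S$ is the set of customer service sets $\sigma_j$: the nonempty subsets of $C$ satisfying the delivery person's capacity restrictions (an upper bound on the number of packages $|\sigma_j|\le q$, and/or on total weight $\sum_{i\in\sigma_j}\psi_i\le\Psi$, and/or on total volume $\sum_{i\in\sigma_j}v_i\le V$, with nonnegative weights and volumes); every singleton $\{i\}$, $i\in C$, satisfies the capacity restrictions. For $i\in C$, $J_i=\{\sigma_j\in S: i\in\sigma_j\}$. Times. $D(i,k)\ge0$ is the driving time from $i$ to $k$ ($i,k\in\Pi$) and $W(i,k)\ge0$ is the walking time from $i$ to $k$ ($i,k\in C\cup\Pi\setminus\{0\}$), with $D(i,i)=W(i,i)=0$; both satisfy the triangle inequality. Set $d_{ik}=D(i,k)+p_k$ for $k\neq0$,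 $i\ne k$, and $d_{i0}=D(i,0)$. For $i\in\Pi\setminus\{0\}$ and $\sigma_j\in S$, $w_{ij}$ is the minimum over orderings $(c_1,\dots,c_m)$ of $\sigma_j$ of $W(i,c_1)+W(c_1,c_2)+\cdots+W(c_{m-1},c_m)+W(c_m,i)$. $f_j$ is the time to load the packages of $\sigma_j$. CDPP. Minimize $$\sum_{i\in\Pi}\sum_{k\in\Pi\setminus\{i\}}x_{ik}d_{ik}+\sum_{i\in\Pi\setminus\{0\}}\sum_{\sigma_j\in S}y_{ij}(w_{ij}+f_j)$$ subject to (1) $\sum_{i\in\Pi\setminus\{0\}}x_{0i}=1$ and $\sum_{i\in\Pi\setminus\{0\}}x_{i0}=1$; (2) $\sum_{k\in\Pi\setminus\{0\}}\sum_{\sigma_j\in J_i}y_{kj}=1$ for all $i\in C$; (3) $\sum_{k\in\Pi\setminus\{i\}}x_{ki}=\sum_{k\in\Pi\setminus\{i\}}x_{ik}$ for all $i\in\Pi\setminus\{0\}$; (4) $y_{ij}\le\sum_{k\in\Pi\setminus\{i\}}x_{ki}$ for all $i\in\Pi\setminus\{0\}$, $\sigma_j\in S$; (5) $\sum_{i\in\Pi\setminus\{0\}}v_{0i}=n$; (6) $v_{ik}\le n\,x_{ik}$ for all $i\in\Pi$, $k\in\Pi\setminus\{0\}$, $i\ne k$; (7) $\sum_{k\in\Pi\setminus\{i\}}v_{ki}-\sum_{k\in\Pi\setminus\{0,i\}}v_{ik}=\sum_{\sigma_j\in S}|\sigma_j|y_{ij}$ for all $i\in\Pi\setminus\{0\}$;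 (8) $x_{ik}\in\{0,1\}$ ($i,k\in\Pi$, $i\neq k$), $y_{ij}\in\{0,1\}$ ($i\in\Pi\setminus\{0\}$, $\sigma_j\in S$), $v_{ik}\in\mathbb Z_{\ge0}$ ($i\in\Pi$, $k\in\Pi\setminus\{0\}$, $i\ne k$). Here $x_{ik}=1$ means the vehicle drives from $i$ to $k$ (and parks at $k$ if $k\ne0$), $y_{ij}=1$ means $\sigma_j$ is served on foot from the vehicle parked at $i$, and $v_{ik}$ is the flow of packages from $i$ to $k$. An optimal solution is an optimal solution of this program. *)

theory Defs
  imports Complex_Main "HOL-Combinatorics.Multiset_Permutations"
begin

text \<open>
  Customers and vehicle stops (the depot and the parking locations) share one type, so that a
  parking location may or may not be a customer. Fields are only meaningful on their index
  ranges; for a capacity bound, \<open>None\<close> means that this restriction is not imposed.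
\<close>

record 'a cdpp =
  customers :: "'a set"
  depot :: 'a
  stops :: "'a set"
  search_time :: "'a \<Rightarrow> real"
  max_packages :: "nat option"
  pkg_weight :: "'a \<Rightarrow> real"
  max_weight :: "real option"
  pkg_volume :: "'a \<Rightarrow> real"
  max_volume :: "real option"
  drive_time :: "'a \<Rightarrow> 'a \<Rightarrow> real"
  walk_time :: "'a \<Rightarrow> 'a \<Rightarrow> real"
  load_time :: "'a set \<Rightarrow> real"

definition parking :: "'a cdpp \<Rightarrow> 'a set" where
  "parking I = stops I - {depot I}"

definition within_capacity :: "'a cdpp \<Rightarrow> 'a set \<Rightarrow> bool" where
  "within_capacity I \<sigma> \<longleftrightarrow>
     (\<forall>q. max_packages I = Some q \<longrightarrow> card \<sigma> \<le> q) \<and>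
     (\<forall>\<Psi>. max_weight I = Some \<Psi> \<longrightarrow> (\<Sum>i\<in>\<sigma>. pkg_weight I i) \<le> \<Psi>) \<and>
     (\<forall>V. max_volume I = Some V \<longrightarrow> (\<Sum>i\<in>\<sigma>. pkg_volume I i) \<le> V)"

definition service_sets :: "'a cdpp \<Rightarrow> 'a set set" where
  "service_sets I = {\<sigma>. \<sigma> \<subseteq> customers I \<and> \<sigma> \<noteq> {} \<and> within_capacity I \<sigma>}"

definition service_sets_of :: "'a cdpp \<Rightarrow> 'a \<Rightarrow> 'a set set" where
  "service_sets_of I i = {\<sigma> \<in> service_sets I. i \<in> \<sigma>}"

definition time_function_on :: "'a set \<Rightarrow> ('a \<Rightarrow> 'a \<Rightarrow> real) \<Rightarrow> bool" where
  "time_function_on A T \<longleftrightarrow>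
     (\<forall>i\<in>A. \<forall>k\<in>A. 0 \<le> T i k) \<and> (\<forall>i\<in>A. T i i = 0) \<and>
     (\<forall>i\<in>A. \<forall>j\<in>A. \<forall>k\<in>A. T i k \<le> T i j + T j k)"

definition cdpp_instance :: "'a cdpp \<Rightarrow> bool" where
  "cdpp_instance I \<longleftrightarrow>
     finite (customers I) \<and> customers I \<noteq> {} \<and>
     finite (stops I) \<and> depot I \<in> stops I \<and> depot I \<notin> customers I \<and> parking I \<noteq> {} \<and>
     (\<forall>i\<in>parking I. 0 \<le> search_time I i) \<and>
     (\<forall>i\<in>customers I. 0 \<le> pkg_weight I i) \<and>
     (\<forall>i\<in>customers I. 0 \<le> pkg_volume I i) \<and>
     (\<forall>i\<in>customers I. within_capacity I {i}) \<and>
     time_function_on (stops I) (drive_time I) \<and>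
     time_function_on (customers I \<union> parking I) (walk_time I)"

definition drive_cost :: "'a cdpp \<Rightarrow> 'a \<Rightarrow> 'a \<Rightarrow> real" where
  "drive_cost I i k =
     (if k = depot I then drive_time I i k else drive_time I i k + search_time I k)"

text \<open>
  For \<open>cs = [c1, \<dots>, cm]\<close> the sum runs over the legs \<open>(i, c1), (c1, c2), \<dots>, (cm, i)\<close>.
\<close>

definition walk_length :: "'a cdpp \<Rightarrow> 'a \<Rightarrow> 'a list \<Rightarrow> real" where
  "walk_length I i cs = sum_list (map2 (walk_time I) (i # cs) (cs @ [i]))"

definition service_walk :: "'a cdpp \<Rightarrow> 'a \<Rightarrow> 'a set \<Rightarrow> real" where
  "service_walk I i \<sigma> = Min (walk_length I i ` permutations_of_set \<sigma>)"

definition cdpp_cost :: "'a cdpp \<Rightarrow> ('a \<Rightarrow> 'a \<Rightarrow> int) \<Rightarrow> ('a \<Rightarrow> 'a set \<Rightarrow> int) \<Rightarrow> real" where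
  "cdpp_cost I x y =
     (\<Sum>i\<in>stops I. \<Sum>k\<in>stops I - {i}. of_int (x i k) * drive_cost I i k) +
     (\<Sum>i\<in>parking I. \<Sum>\<sigma>\<in>service_sets I. of_int (y i \<sigma>) * (service_walk I i \<sigma> + load_time I \<sigma>))"

text \<open>
  The values of \<open>x\<close>, \<open>y\<close> and \<open>v\<close> outside the index ranges of the integer program are irrelevant
  and left unconstrained.
\<close>

definition cdpp_feasible ::
    "'a cdpp \<Rightarrow> ('a \<Rightarrow> 'a \<Rightarrow> int) \<Rightarrow> ('a \<Rightarrow> 'a set \<Rightarrow> int) \<Rightarrow> ('a \<Rightarrow> 'a \<Rightarrow> int) \<Rightarrow> bool" where
  "cdpp_feasible I x y v \<longleftrightarrow>
     (\<Sum>i\<in>parking I. x (depot I) i) = 1 \<and>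
     (\<Sum>i\<in>parking I. x i (depot I)) = 1 \<and>
     (\<forall>i\<in>customers I. (\<Sum>k\<in>parking I. \<Sum>\<sigma>\<in>service_sets_of I i. y k \<sigma>) = 1) \<and>
     (\<forall>i\<in>parking I. (\<Sum>k\<in>stops I - {i}. x k i) = (\<Sum>k\<in>stops I - {i}. x i k)) \<and>
     (\<forall>i\<in>parking I. \<forall>\<sigma>\<in>service_sets I. y i \<sigma> \<le> (\<Sum>k\<in>stops I - {i}. x k i)) \<and>
     (\<Sum>i\<in>parking I. v (depot I) i) = int (card (customers I)) \<and>
     (\<forall>i\<in>stops I. \<forall>k\<in>parking I. i \<noteq> k \<longrightarrow> v i k \<le> int (card (customers I)) * x i k) \<and>
     (\<forall>i\<in>parking I.
        (\<Sum>k\<in>stops I - {i}. v k i) - (\<Sum>k\<in>stops I - {depot I, i}. v i k)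
          = (\<Sum>\<sigma>\<in>service_sets I. int (card \<sigma>) * y i \<sigma>)) \<and>
     (\<forall>i\<in>stops I. \<forall>k\<in>stops I. i \<noteq> k \<longrightarrow> x i k \<in> {0, 1}) \<and>
     (\<forall>i\<in>parking I. \<forall>\<sigma>\<in>service_sets I. y i \<sigma> \<in> {0, 1}) \<and>
     (\<forall>i\<in>stops I. \<forall>k\<in>parking I. i \<noteq> k \<longrightarrow> 0 \<le> v i k)"

definition cdpp_optimal ::
    "'a cdpp \<Rightarrow> ('a \<Rightarrow> 'a \<Rightarrow> int) \<Rightarrow> ('a \<Rightarrow> 'a set \<Rightarrow> int) \<Rightarrow> ('a \<Rightarrow> 'a \<Rightarrow> int) \<Rightarrow> bool" where
  "cdpp_optimal I x y v \<longleftrightarrow>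
     cdpp_feasible I x y v \<and>
     (\<forall>x' y' v'. cdpp_feasible I x' y' v' \<longrightarrow> cdpp_cost I x y \<le> cdpp_cost I x' y')"

end

theory Submission
  imports Defs "HOL-Library.Sublist"
begin

text \<open>
  Loading costs \<open>f\<close> per package and every customer is served exactly once, so all feasible
  solutions pay the same amount \<open>f n\<close> for loading; only driving and walking matter.

  Walking: if the vehicle parks at a customer \<open>i\<close>, let it serve \<open>{i}\<close> from there, a walk of
  length \<open>0\<close>, and delete \<open>i\<close> from the service set that contained it. By the triangle inequality
  deleting customers does not lengthen a walk, and the smaller set still respects the capacities
  (\<open>reassign_own\<close>).

  Driving: the claimed equation also says that the vehicle parks at most once at each location
  that is a customer, and does not park there if it serves nobody from there. The chosen arcs form
  a balanced digraph in which the package flow makes every serving location reachable from the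
  depot. As in Euler's theorem, a longest closed trail from the depot meets everything reachable
  (\<open>balanced_trail_reaches\<close>); shortcutting it by the triangle inequality yields a tour that
  meets precisely the serving locations, each once, at no greater cost (\<open>feasible_tour\<close>). The
  Eulerian detour is needed because shortcutting at one location in the arc variables themselves
  could use an arc twice, which \<open>x i k \<le> 1\<close> forbids.

  Hence every feasible solution is matched or improved by a tour and an assignment of service
  sets to its stops that have the required form; these are called plans (\<open>feasible_plan\<close>). Every
  plan is realised by a feasible solution of the same cost (\<open>plan_feasible\<close>), and there are only
  finitely many plans, so a cheapest plan gives the optimal solution sought.
\<close>

section \<open>Walks and their lengths\<close>

definition steps :: "'a list \<Rightarrow> ('a \<times> 'a) list" where
  "steps vs = zip vs (tl vs)"

definition path_length :: "('a \<Rightarrow> 'a \<Rightarrow> real) \<Rightarrow> 'a list \<Rightarrow> real" where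
  "path_length c vs = (\<Sum>(a, b)\<leftarrow>steps vs. c a b)"

lemma steps_simps [simp]:
  "steps [] = []" "steps [a] = []" "steps (a # b # vs) = (a, b) # steps (b # vs)"
  by (simp_all add: steps_def)

lemma steps_append: "steps (xs @ y # zs) = steps (xs @ [y]) @ steps (y # zs)"
proof (induction xs)
  case (Cons x xs)
  then show ?case by (cases xs) auto
qed simp

lemma steps_in_set: "(a, b) \<in> set (steps vs) \<Longrightarrow> a \<in> set vs \<and> b \<in> set vs"
  unfolding steps_def by (metis list.sel(2) list.set_sel(2) set_zip_leftD set_zip_rightD)

lemma path_length_simps [simp]:
  "path_length c [a] = 0" "path_length c (a # b # vs) = c a b + path_length c (b # vs)"
  by (simp_all add: path_length_def)

lemma path_length_distinct:
  "distinct (steps vs) \<Longrightarrow> path_length c vs = (\<Sum>(a, b)\<in>set (steps vs). c a b)"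
  by (simp add: path_length_def sum_list_distinct_conv_sum_set)

lemma steps_closed: "steps (a # xs @ [b]) = zip (a # xs) (xs @ [b])"
  by (induction xs arbitrary: a) auto

lemma set_steps: "set vs \<subseteq> insert (hd vs) (snd ` set (steps vs))"
proof (induction vs)
  case (Cons v vs)
  then show ?case by (cases vs) auto
qed simp

text \<open>
  Shortcutting, used both for the vehicle and for the walks of the delivery person. The induction
  has to move the starting point \<open>a\<close>, since skipping the first vertex merges two steps into
  one that starts at \<open>a\<close>.
\<close>

lemma path_length_subseq:
  assumes "subseq ys xs"
    and "a \<in> V" "b \<in> V" "set xs \<subseteq> V"
    and triangle: "\<And>u v w. u \<in> V \<Longrightarrow> v \<in> V \<Longrightarrow> w \<in> V \<Longrightarrow> c u w \<le> c u v + c v w"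
  shows "path_length c (a # ys @ [b]) \<le> path_length c (a # xs @ [b])"
  using assms(1-4)
proof (induction arbitrary: a rule: list_emb.induct)
  case (list_emb_Nil xs)
  then show ?case
  proof (induction xs arbitrary: a)
    case (Cons x xs)
    then have "c a b \<le> c a x + c x b" "path_length c (x # [] @ [b]) \<le> path_length c (x # xs @ [b])"
      using triangle by (auto simp del: path_length_simps)
    then show ?case by simp
  qed simp
next
  case (list_emb_Cons ys xs x)
  have "path_length c (a # xs @ [b]) \<le> path_length c (a # ([x] @ xs) @ [b])"
    using list_emb_Cons.prems triangle[of a x] by (cases xs) auto
  then show ?case using list_emb_Cons.IH[of a] list_emb_Cons.prems by simp
next
  case (list_emb_Cons2 x y xs ys)
  then show ?case by simp
qed

lemma subseq_remdups: "subseq (remdups xs) xs"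
  by (induction xs) (auto intro: subseq_order.order_trans)

section \<open>Closed trails in balanced digraphs\<close>

definition trail :: "('a \<times> 'a) set \<Rightarrow> 'a \<Rightarrow> 'a list \<Rightarrow> 'a \<Rightarrow> bool" where
  "trail E a vs b \<longleftrightarrow>
     vs \<noteq> [] \<and> hd vs = a \<and> last vs = b \<and> distinct (steps vs) \<and> set (steps vs) \<subseteq> E"

definition balanced :: "('a \<times> 'a) set \<Rightarrow> bool" where
  "balanced E \<longleftrightarrow> (\<forall>w. card {e \<in> E. snd e = w} = card {e \<in> E. fst e = w})"

lemma trail_length:
  assumes "finite E" "trail E a vs b"
  shows "length vs < card E + 2"
proof -
  have "length (steps vs) \<le> card E"
    using assms unfolding trail_def by (metis card_mono distinct_card)
  then show ?thesis by (simp add: steps_def)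
qed

text \<open>
  The unbalance of a trail at its ends: if it is closed, removing it keeps a digraph balanced,
  and if it is not, in a balanced digraph some unused arc leaves its last vertex.
\<close>

lemma trail_degrees:
  assumes "trail E a vs b"
  shows "card {e \<in> set (steps vs). snd e = w} + of_bool (w = a) =
    card {e \<in> set (steps vs). fst e = w} + of_bool (w = b)"
proof -
  have "vs \<noteq> [] \<Longrightarrow> length (filter (\<lambda>e. snd e = w) (steps vs)) + of_bool (w = hd vs) =
      length (filter (\<lambda>e. fst e = w) (steps vs)) + of_bool (w = last vs)"
  proof (induction vs)
    case (Cons v vs)
    then show ?case by (cases vs) (auto split: if_splits)
  qed simp
  then show ?thesis
    using assms unfolding trail_def by (simp add: distinct_length_filter Int_def conj_commute)
qed

text \<open>
  A longest trail from \<open>u\<close> has to close, as it could be extended at any other last vertex.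
\<close>

lemma balanced_closed_trail:
  assumes "finite E" "balanced E" "(u, w) \<in> E"
  obtains vs where "trail E u vs u" "length vs > 1"
proof -
  have start: "trail E u [u, w] w" using assms by (simp add: trail_def)
  obtain vs where vs: "\<exists>b. trail E u vs b"
    and max: "\<And>vs'. \<exists>b. trail E u vs' b \<Longrightarrow> length vs' \<le> length vs"
    using ex_has_greatest_nat[of "\<lambda>vs. \<exists>b. trail E u vs b" "[u, w]" length "card E + 2"]
      start trail_length[OF assms(1)] by blast
  obtain b where b: "trail E u vs b" using vs by blast
  let ?F = "set (steps vs)"
  have "b = u"
  proof (rule ccontr)
    assume "b \<noteq> u"
    have "card {e \<in> ?F. fst e = b} < card {e \<in> ?F. snd e = b}"
      using trail_degrees[OF b, of b] \<open>b \<noteq> u\<close> by simp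
    also have "\<dots> \<le> card {e \<in> E. snd e = b}"
      using b assms(1) by (intro card_mono) (auto simp: trail_def)
    also have "\<dots> = card {e \<in> E. fst e = b}" using assms(2) by (simp add: balanced_def)
    finally have "\<not> {e \<in> E. fst e = b} \<subseteq> {e \<in> ?F. fst e = b}"
      using card_mono[of "{e \<in> ?F. fst e = b}" "{e \<in> E. fst e = b}"] by auto
    then obtain z where z: "(b, z) \<in> E" "(b, z) \<notin> ?F"
      by (smt (verit) mem_Collect_eq prod.collapse subsetI)
    have "vs = butlast vs @ [b]" using b by (auto simp: trail_def)
    then have "steps (vs @ [z]) = steps vs @ [(b, z)]"
      using steps_append[of "butlast vs" b "[z]"] by (metis append_Cons append_Nil append_assoc steps_simps(2,3))
    then have "trail E u (vs @ [z]) z" using b z by (auto simp: trail_def)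
    then show False using max[of "vs @ [z]"] by auto
  qed
  moreover have "length vs > 1" using max[of "[u, w]"] start by fastforce
  ultimately show ?thesis using b that by blast
qed

text \<open>
  Hierholzer's argument: were an unused arc to leave a longest closed trail, the remaining
  balanced digraph would contain a closed trail through that arc's tail, which could be spliced
  in. So the vertices of the trail are closed under successors.
\<close>

lemma balanced_trail_reaches:
  assumes "finite E" "balanced E"
  obtains vs where "trail E r vs r" "E\<^sup>* `` {r} \<subseteq> set vs"
proof -
  have start: "trail E r [r] r" by (simp add: trail_def)
  obtain vs where vs: "trail E r vs r"
    and max: "\<And>vs'. trail E r vs' r \<Longrightarrow> length vs' \<le> length vs"
    using ex_has_greatest_nat[of "\<lambda>vs. trail E r vs r" "[r]" length "card E + 2"]
      start trail_length[OF assms(1)] by blast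
  let ?F = "set (steps vs)"
  have F: "?F \<subseteq> E" using vs by (simp add: trail_def)
  have bal: "balanced (E - ?F)"
    unfolding balanced_def
  proof
    fix w
    have split: "card {e \<in> E - ?F. P e} = card {e \<in> E. P e} - card {e \<in> ?F. P e}" for P
    proof -
      have "{e \<in> E - ?F. P e} = {e \<in> E. P e} - {e \<in> ?F. P e}" by auto
      then show ?thesis using F by (simp add: card_Diff_subset Collect_mono_iff subset_iff)
    qed
    show "card {e \<in> E - ?F. snd e = w} = card {e \<in> E - ?F. fst e = w}"
      unfolding split using trail_degrees[OF vs, of w] assms(2) by (simp add: balanced_def)
  qed
  have closed: "w \<in> set vs" if u: "u \<in> set vs" and uw: "(u, w) \<in> E" for u w
  proof (rule ccontr)
    assume "w \<notin> set vs"
    then have "(u, w) \<in> E - ?F" using uw steps_in_set by fast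
    then obtain us where us: "trail (E - ?F) u us u" "length us > 1"
      using balanced_closed_trail[OF _ bal] assms(1) by blast
    obtain xs ys where vs_eq: "vs = xs @ u # ys" using u by (meson split_list)
    obtain us0 where us0: "us = us0 @ [u]"
      using us by (metis trail_def append_butlast_last_id)
    obtain us1 where us1: "us = u # us1"
      using us by (metis trail_def list.collapse)
    have "steps (xs @ us @ ys) = steps (xs @ [u]) @ steps (us @ ys)"
      using steps_append[of xs u "us1 @ ys"] by (simp add: us1)
    also have "steps (us @ ys) = steps us @ steps (u # ys)"
      using steps_append[of us0 u ys] by (simp add: us0)
    finally have st: "steps (xs @ us @ ys) = steps (xs @ [u]) @ steps us @ steps (u # ys)" .
    have st': "steps vs = steps (xs @ [u]) @ steps (u # ys)"
      unfolding vs_eq by (rule steps_append)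
    have "hd (xs @ us @ ys) = r" using vs us1 by (cases xs) (auto simp: trail_def vs_eq)
    moreover have "last (xs @ us @ ys) = r"
      using vs us0 by (cases "ys = []") (auto simp: trail_def vs_eq)
    moreover have "distinct (steps (xs @ us @ ys))" "set (steps (xs @ us @ ys)) \<subseteq> E"
      using vs us(1) unfolding trail_def st by (auto simp: st')
    ultimately have "trail E r (xs @ us @ ys) r" using us1 by (simp add: trail_def)
    then show False using max us(2) by (fastforce simp: vs_eq)
  qed
  have "w \<in> set vs" if "(r, w) \<in> E\<^sup>*" for w
    using that
  proof (induction rule: rtrancl_induct)
    case base
    then show ?case using vs by (auto simp: trail_def)
  next
    case (step y z)
    then show ?case using closed by blast
  qed
  then show ?thesis using vs that by blast
qed

section \<open>Tours through distinct stops\<close>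

lemma tour_neighbours:
  assumes "distinct (r # as @ i # bs)"
  shows "(k, i) \<in> set (steps (r # (as @ i # bs) @ [r])) \<longleftrightarrow> k = last (r # as)"
    and "(i, k) \<in> set (steps (r # (as @ i # bs) @ [r])) \<longleftrightarrow> k = hd (bs @ [r])"
proof -
  define us where "us = butlast (r # as)"
  define p where "p = last (r # as)"
  have p: "r # as = us @ [p]" by (simp add: us_def p_def)
  obtain s ws where s: "bs @ [r] = s # ws" by (cases "bs @ [r]") auto
  have "steps (r # (as @ i # bs) @ [r]) = steps ((us @ [p]) @ i # s # ws)"
    using p s by (metis append_Cons append_assoc)
  also have "\<dots> = steps (us @ [p]) @ (p, i) # (i, s) # steps (s # ws)"
    using steps_append[of us p "i # s # ws"] by simp
  finally have st: "steps (r # (as @ i # bs) @ [r]) =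
      steps (us @ [p]) @ (p, i) # (i, s) # steps (s # ws)" .
  have "i \<notin> set (us @ [p])" "i \<notin> set (s # ws)"
    using assms by (auto simp flip: p s)
  moreover from this have "(k, i) \<notin> set (steps (us @ [p]))" "(i, k) \<notin> set (steps (us @ [p]))"
    "(k, i) \<notin> set (steps (s # ws))" "(i, k) \<notin> set (steps (s # ws))"
    using steps_in_set by fast+
  ultimately show "(k, i) \<in> set (steps (r # (as @ i # bs) @ [r])) \<longleftrightarrow> k = last (r # as)"
    and "(i, k) \<in> set (steps (r # (as @ i # bs) @ [r])) \<longleftrightarrow> k = hd (bs @ [r])"
    unfolding st s p_def[symmetric] by auto
qed

lemma tour_ends:
  assumes "distinct (r # ts)" "ts \<noteq> []"
  shows "(r, k) \<in> set (steps (r # ts @ [r])) \<longleftrightarrow> k = hd ts"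
    and "(k, r) \<in> set (steps (r # ts @ [r])) \<longleftrightarrow> k = last ts"
proof -
  obtain t ts' where t: "ts = t # ts'" using assms(2) by (cases ts) auto
  have st: "steps (r # ts @ [r]) = (r, t) # steps (ts @ [r])" by (simp add: t)
  have *: "steps (ts @ [r]) = steps ts @ [(last ts, r)]"
    using steps_append[of "butlast ts" "last ts" "[r]"] assms(2)
    by (metis append_Cons append_Nil append_assoc append_butlast_last_id steps_simps(2,3))
  have n: "(r, k) \<notin> set (steps ts)" "(k, r) \<notin> set (steps ts)" for k
    using assms(1) steps_in_set[of _ _ ts] by fastforce+
  have "last ts \<noteq> r" "t \<noteq> r" using assms t by auto
  then show "(r, k) \<in> set (steps (r # ts @ [r])) \<longleftrightarrow> k = hd ts"
    and "(k, r) \<in> set (steps (r # ts @ [r])) \<longleftrightarrow> k = last ts"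
    unfolding st * using n by (auto simp: t)
qed

section \<open>Plans\<close>

definition exact_cover :: "'a set \<Rightarrow> ('b \<times> 'a set) set \<Rightarrow> bool" where
  "exact_cover C A \<longleftrightarrow> (\<forall>i\<in>C. card {p \<in> A. i \<in> snd p} = 1)"

lemma exact_cover_sum_card:
  assumes "finite C" "finite A" "exact_cover C A" "\<And>p. p \<in> A \<Longrightarrow> snd p \<subseteq> C"
  shows "(\<Sum>p\<in>A. card (snd p)) = card C"
proof -
  have "(\<Sum>p\<in>A. card (snd p)) = (\<Sum>p\<in>A. card {i \<in> C. i \<in> snd p})"
    using assms(4) by (intro sum.cong refl arg_cong[where f = card]) auto
  also have "\<dots> = 1 * card C"
    using assms by (intro sum_multicount) (auto simp: exact_cover_def)
  finally show ?thesis by simp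
qed

text \<open>
  The tour \<open>ts\<close> omits the depot, where it begins and ends. It may contain non-customers
  from which nobody is served, as other stops may have taken over all their customers.
\<close>

definition plan :: "'a cdpp \<Rightarrow> 'a list \<Rightarrow> ('a \<times> 'a set) set \<Rightarrow> bool" where
  "plan I ts A \<longleftrightarrow>
     distinct ts \<and> set ts \<subseteq> parking I \<and> A \<subseteq> set ts \<times> service_sets I \<and>
     exact_cover (customers I) A \<and> (\<forall>k \<in> set ts \<inter> customers I. (k, {k}) \<in> A)"

text \<open>
  The loading time is left out, being the same for all solutions.
\<close>

definition plan_cost :: "'a cdpp \<Rightarrow> 'a list \<Rightarrow> ('a \<times> 'a set) set \<Rightarrow> real" where
  "plan_cost I ts A =
     path_length (drive_cost I) (depot I # ts @ [depot I]) + (\<Sum>(k, \<sigma>)\<in>A. service_walk I k \<sigma>)"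

definition driven :: "'a cdpp \<Rightarrow> ('a \<Rightarrow> 'a \<Rightarrow> int) \<Rightarrow> ('a \<times> 'a) set" where
  "driven I x = {(i, k). i \<in> stops I \<and> k \<in> stops I - {i} \<and> x i k = 1}"

definition assigned :: "'a cdpp \<Rightarrow> ('a \<Rightarrow> 'a set \<Rightarrow> int) \<Rightarrow> ('a \<times> 'a set) set" where
  "assigned I y = {(k, \<sigma>). k \<in> parking I \<and> \<sigma> \<in> service_sets I \<and> y k \<sigma> = 1}"

lemma sum_binary:
  fixes z :: "'b \<Rightarrow> int"
  assumes "finite B" "\<And>b. b \<in> B \<Longrightarrow> z b \<in> {0, 1}"
  shows "(\<Sum>b\<in>B. z b) = int (card {b \<in> B. z b = 1})"
proof -
  have "(\<Sum>b\<in>B. z b) = (\<Sum>b\<in>B. if z b = 1 then 1 else 0)"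
    using assms(2) by (intro sum.cong) auto
  then show ?thesis using assms(1) by (simp add: sum.If_cases Int_def conj_commute)
qed

lemma sum_binary_weighted:
  fixes z :: "'a \<Rightarrow> 'b \<Rightarrow> int" and c :: "'a \<Rightarrow> 'b \<Rightarrow> real"
  assumes "finite A" "\<And>a. a \<in> A \<Longrightarrow> finite (B a)" "\<And>a b. a \<in> A \<Longrightarrow> b \<in> B a \<Longrightarrow> z a b \<in> {0, 1}"
  shows "(\<Sum>a\<in>A. \<Sum>b\<in>B a. of_int (z a b) * c a b) =
    (\<Sum>(a, b)\<in>{(a, b). a \<in> A \<and> b \<in> B a \<and> z a b = 1}. c a b)"
proof -
  have "(\<Sum>a\<in>A. \<Sum>b\<in>B a. of_int (z a b) * c a b) =
      (\<Sum>(a, b)\<in>Sigma A B. of_int (z a b) * c a b)"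
    using assms by (simp add: sum.Sigma)
  also have "\<dots> = (\<Sum>(a, b)\<in>{(a, b). a \<in> A \<and> b \<in> B a \<and> z a b = 1}. c a b)"
    using assms(1,2) by (intro sum.mono_neutral_cong_right) (use assms(3) in fastforce)+
  finally show ?thesis .
qed

context
  fixes I :: "'a cdpp"
  assumes inst: "cdpp_instance I"
begin

lemma finite_sets:
  "finite (customers I)" "finite (stops I)" "finite (parking I)" "finite (service_sets I)"
proof -
  show C: "finite (customers I)" and S: "finite (stops I)" using inst by (auto simp: cdpp_instance_def)
  show "finite (parking I)" using S by (simp add: parking_def)
  have "service_sets I \<subseteq> Pow (customers I)" by (auto simp: service_sets_def)
  then show "finite (service_sets I)" using C by (meson finite_Pow_iff finite_subset)
qed

subsection \<open>Driving costs, capacities and service walks\<close>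

lemma drive_cost_nonneg: "i \<in> stops I \<Longrightarrow> k \<in> stops I \<Longrightarrow> 0 \<le> drive_cost I i k"
  using inst by (auto simp: drive_cost_def cdpp_instance_def time_function_on_def parking_def)

lemma drive_cost_triangle:
  assumes "i \<in> stops I" "j \<in> stops I" "k \<in> stops I"
  shows "drive_cost I i k \<le> drive_cost I i j + drive_cost I j k"
proof -
  have "drive_time I i k \<le> drive_time I i j + drive_time I j k"
    using inst assms by (auto simp: cdpp_instance_def time_function_on_def)
  moreover have "j \<noteq> depot I \<Longrightarrow> 0 \<le> search_time I j"
    using inst assms by (auto simp: cdpp_instance_def parking_def)
  ultimately show ?thesis by (auto simp: drive_cost_def)
qed

lemma within_capacity_mono:
  assumes "\<tau> \<subseteq> \<sigma>" "\<sigma> \<subseteq> customers I" "within_capacity I \<sigma>"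
  shows "within_capacity I \<tau>"
proof -
  have fin: "finite \<sigma>" using assms finite_sets finite_subset by blast
  have "card \<tau> \<le> card \<sigma>" using fin assms by (simp add: card_mono)
  moreover have "(\<Sum>i\<in>\<tau>. pkg_weight I i) \<le> (\<Sum>i\<in>\<sigma>. pkg_weight I i)"
    "(\<Sum>i\<in>\<tau>. pkg_volume I i) \<le> (\<Sum>i\<in>\<sigma>. pkg_volume I i)"
    using inst assms fin by (auto intro!: sum_mono2 simp: cdpp_instance_def subset_iff)
  ultimately show ?thesis
    using assms(3) unfolding within_capacity_def by (meson order_trans)
qed

lemma service_sets_subset:
  "\<sigma> \<in> service_sets I \<Longrightarrow> \<tau> \<subseteq> \<sigma> \<Longrightarrow> \<tau> \<noteq> {} \<Longrightarrow> \<tau> \<in> service_sets I"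
  unfolding service_sets_def using within_capacity_mono[of \<tau> \<sigma>] by (simp add: subset_trans)

lemma singleton_service_set: "i \<in> customers I \<Longrightarrow> {i} \<in> service_sets I"
  using inst by (auto simp: service_sets_def cdpp_instance_def)

lemma service_walk_mono:
  assumes "k \<in> parking I" "\<sigma> \<subseteq> customers I" "\<tau> \<subseteq> \<sigma>"
  shows "service_walk I k \<tau> \<le> service_walk I k \<sigma>"
proof -
  have fin: "finite \<sigma>" "finite \<tau>" using assms(2,3) finite_sets(1) by (auto intro: finite_subset)
  have walk: "walk_length I k cs = path_length (walk_time I) (k # cs @ [k])" for cs
    by (simp add: walk_length_def path_length_def steps_closed)
  have "Min (walk_length I k ` permutations_of_set \<sigma>) \<in> walk_length I k ` permutations_of_set \<sigma>"
    using fin by (intro Min_in) auto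
  then obtain cs where cs: "cs \<in> permutations_of_set \<sigma>" "service_walk I k \<sigma> = walk_length I k cs"
    by (auto simp: service_walk_def)
  let ?ds = "filter (\<lambda>c. c \<in> \<tau>) cs"
  have "?ds \<in> permutations_of_set \<tau>"
    using cs(1) assms(3) by (auto simp: permutations_of_set_def)
  then have "service_walk I k \<tau> \<le> walk_length I k ?ds"
    using fin by (auto simp: service_walk_def)
  also have "\<dots> \<le> walk_length I k cs"
    unfolding walk
  proof (rule path_length_subseq[where V = "customers I \<union> parking I"])
    show "set cs \<subseteq> customers I \<union> parking I"
      using cs(1) assms(2) by (auto simp: permutations_of_set_def)
    show "walk_time I u w \<le> walk_time I u v + walk_time I v w"
      if "u \<in> customers I \<union> parking I" "v \<in> customers I \<union> parking I" "w \<in> customers I \<union> parking I"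
      for u v w
      using inst that unfolding cdpp_instance_def time_function_on_def by blast
  qed (use assms(1) in auto)
  finally show ?thesis using cs(2) by simp
qed

lemma walk_time_self: "k \<in> parking I \<Longrightarrow> walk_time I k k = 0"
  using inst unfolding cdpp_instance_def time_function_on_def by blast

lemma service_walk_nonneg:
  assumes "k \<in> parking I" "\<sigma> \<subseteq> customers I"
  shows "0 \<le> service_walk I k \<sigma>"
proof -
  have "service_walk I k {} = 0"
    using walk_time_self[OF assms(1)] by (simp add: service_walk_def walk_length_def)
  then show ?thesis using service_walk_mono[OF assms, of "{}"] by simp
qed

lemma service_walk_own: "k \<in> parking I \<Longrightarrow> service_walk I k {k} = 0"
  using walk_time_self by (simp add: service_walk_def walk_length_def)

subsection \<open>From feasible solutions to plans\<close>

lemma feasible_binary: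
  assumes "cdpp_feasible I x y v"
  shows "i \<in> stops I \<Longrightarrow> k \<in> stops I \<Longrightarrow> i \<noteq> k \<Longrightarrow> x i k \<in> {0, 1}"
    and "i \<in> parking I \<Longrightarrow> \<sigma> \<in> service_sets I \<Longrightarrow> y i \<sigma> \<in> {0, 1}"
  using assms by (simp_all add: cdpp_feasible_def)

text \<open>This turns the covering constraint into the exactness of the assignment.\<close>

lemma sum_service_sets_of:
  assumes "\<And>k \<sigma>. k \<in> parking I \<Longrightarrow> \<sigma> \<in> service_sets I \<Longrightarrow> y k \<sigma> \<in> {0, 1}"
  shows "(\<Sum>k\<in>parking I. \<Sum>\<sigma>\<in>service_sets_of I i. y k \<sigma>) = int (card {p \<in> assigned I y. i \<in> snd p})"
proof -
  have fin: "finite (service_sets_of I i)" using finite_sets by (simp add: service_sets_of_def)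
  have "(\<Sum>k\<in>parking I. \<Sum>\<sigma>\<in>service_sets_of I i. y k \<sigma>) =
      (\<Sum>p\<in>parking I \<times> service_sets_of I i. y (fst p) (snd p))"
    by (simp add: sum.cartesian_product case_prod_unfold)
  also have "\<dots> = int (card {p \<in> parking I \<times> service_sets_of I i. y (fst p) (snd p) = 1})"
    using fin finite_sets assms by (intro sum_binary) (fastforce simp: service_sets_of_def)+
  also have "{p \<in> parking I \<times> service_sets_of I i. y (fst p) (snd p) = 1} =
      {p \<in> assigned I y. i \<in> snd p}"
    by (auto simp: assigned_def service_sets_of_def)
  finally show ?thesis .
qed

lemma feasible_exact_cover:
  assumes "cdpp_feasible I x y v"
  shows "exact_cover (customers I) (assigned I y)"
  unfolding exact_cover_def
proof
  fix i assume "i \<in> customers I"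
  then have "(\<Sum>k\<in>parking I. \<Sum>\<sigma>\<in>service_sets_of I i. y k \<sigma>) = 1"
    using assms by (simp add: cdpp_feasible_def)
  then show "card {p \<in> assigned I y. i \<in> snd p} = 1"
    using sum_service_sets_of[of y i] feasible_binary(2)[OF assms] by simp
qed

lemma finite_assigned: "finite (assigned I y)"
  by (rule finite_subset[of _ "parking I \<times> service_sets I"]) (auto simp: assigned_def finite_sets)

lemma finite_driven: "finite (driven I x)"
  by (rule finite_subset[of _ "stops I \<times> stops I"]) (auto simp: driven_def finite_sets)

lemma feasible_cost:
  assumes feas: "cdpp_feasible I x y v"
    and load: "\<And>\<sigma>. \<sigma> \<in> service_sets I \<Longrightarrow> load_time I \<sigma> = f * real (card \<sigma>)"
  shows "cdpp_cost I x y =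
    (\<Sum>(i, k)\<in>driven I x. drive_cost I i k) + (\<Sum>(k, \<sigma>)\<in>assigned I y. service_walk I k \<sigma>) +
    f * real (card (customers I))"
proof -
  have "(\<Sum>p\<in>assigned I y. card (snd p)) = card (customers I)"
    using feasible_exact_cover[OF feas] finite_assigned finite_sets
    by (intro exact_cover_sum_card) (auto simp: assigned_def service_sets_def)
  then have n: "f * real (card (customers I)) = (\<Sum>p\<in>assigned I y. f * real (card (snd p)))"
    by (metis of_nat_sum sum_distrib_left)
  have "(\<Sum>i\<in>stops I. \<Sum>k\<in>stops I - {i}. of_int (x i k) * drive_cost I i k) =
      (\<Sum>(i, k)\<in>driven I x. drive_cost I i k)"
    unfolding driven_def using feasible_binary(1)[OF feas] finite_sets
    by (intro sum_binary_weighted) auto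
  moreover have "(\<Sum>i\<in>parking I. \<Sum>\<sigma>\<in>service_sets I. of_int (y i \<sigma>) * (service_walk I i \<sigma> + load_time I \<sigma>)) =
      (\<Sum>(k, \<sigma>)\<in>assigned I y. service_walk I k \<sigma> + load_time I \<sigma>)"
    unfolding assigned_def using feasible_binary(2)[OF feas] finite_sets
    by (intro sum_binary_weighted) auto
  moreover have "\<dots> = (\<Sum>p\<in>assigned I y. service_walk I (fst p) (snd p) + f * real (card (snd p)))"
    using load by (intro sum.cong) (auto simp: assigned_def)
  ultimately show ?thesis
    by (simp add: cdpp_cost_def n sum.distrib case_prod_unfold)
qed

lemma feasible_balanced:
  assumes feas: "cdpp_feasible I x y v"
  shows "balanced (driven I x)"
  unfolding balanced_def
proof
  fix w
  show "card {e \<in> driven I x. snd e = w} = card {e \<in> driven I x. fst e = w}"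
  proof (cases "w \<in> stops I")
    case True
    have "{e \<in> driven I x. snd e = w} = (\<lambda>k. (k, w)) ` {k \<in> stops I - {w}. x k w = 1}"
      using True by (auto simp: driven_def)
    then have "int (card {e \<in> driven I x. snd e = w}) = int (card {k \<in> stops I - {w}. x k w = 1})"
      by (simp add: card_image inj_on_def)
    also have "\<dots> = (\<Sum>k\<in>stops I - {w}. x k w)"
      using feasible_binary(1)[OF feas] True finite_sets by (intro sum_binary[symmetric]) auto
    also have "\<dots> = (\<Sum>k\<in>stops I - {w}. x w k)"
      using feas True by (cases "w = depot I") (auto simp: cdpp_feasible_def parking_def)
    also have "\<dots> = int (card {k \<in> stops I - {w}. x w k = 1})"
      using feasible_binary(1)[OF feas] True finite_sets by (intro sum_binary) auto
    also have "\<dots> = int (card {e \<in> driven I x. fst e = w})"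
    proof -
      have "{e \<in> driven I x. fst e = w} = (\<lambda>k. (w, k)) ` {k \<in> stops I - {w}. x w k = 1}"
        using True by (auto simp: driven_def)
      then show ?thesis by (simp add: card_image inj_on_def)
    qed
    finally show ?thesis by simp
  next
    case False
    then have "{e \<in> driven I x. snd e = w} = {}" "{e \<in> driven I x. fst e = w} = {}"
      by (auto simp: driven_def)
    then show ?thesis by (simp only: card.empty)
  qed
qed

text \<open>
  No flow enters the set \<open>U\<close> of unreachable parking locations, so summing the conservation of
  flow over \<open>U\<close> shows that nothing is delivered from there.
\<close>

lemma feasible_reachable:
  assumes feas: "cdpp_feasible I x y v" and "(k, \<sigma>) \<in> assigned I y"
  shows "(depot I, k) \<in> (driven I x)\<^sup>*"
proof (rule ccontr)
  assume unreached: "(depot I, k) \<notin> (driven I x)\<^sup>*"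
  define U where "U = {i \<in> parking I. (depot I, i) \<notin> (driven I x)\<^sup>*}"
  define m where "m i = (\<Sum>\<sigma>\<in>service_sets I. int (card \<sigma>) * y i \<sigma>)" for i
  have k: "k \<in> U" using unreached assms(2) by (auto simp: U_def assigned_def)
  have U: "U \<subseteq> parking I" "U \<subseteq> stops I" "depot I \<notin> U" "finite U"
    using finite_sets by (auto simp: U_def parking_def)
  have y01: "y i \<tau> \<in> {0, 1}" if "i \<in> parking I" "\<tau> \<in> service_sets I" for i \<tau>
    using feasible_binary(2)[OF feas that] .
  have v0: "0 \<le> v i k" if "i \<in> stops I" "k \<in> parking I" "i \<noteq> k" for i k
    using feas that by (simp add: cdpp_feasible_def)
  have v1: "v i k \<le> int (card (customers I)) * x i k" if "i \<in> stops I" "k \<in> parking I" "i \<noteq> k" for i k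
    using feas that by (simp add: cdpp_feasible_def)
  have into: "v i k = 0" if "i \<in> stops I - U" "k \<in> U" for i k
  proof -
    have "(depot I, i) \<in> (driven I x)\<^sup>*" using that by (auto simp: U_def parking_def)
    moreover have "(depot I, k) \<notin> (driven I x)\<^sup>*" using that by (auto simp: U_def)
    ultimately have "(i, k) \<notin> driven I x" by (meson rtrancl.rtrancl_into_rtrancl)
    moreover have "i \<noteq> k" "i \<in> stops I" "k \<in> stops I" "k \<in> parking I" using that U by auto
    ultimately have "x i k = 0" using feasible_binary(1)[OF feas, of i k] by (auto simp: driven_def)
    then show ?thesis
      using v0[of i k] v1[of i k] \<open>i \<noteq> k\<close> \<open>i \<in> stops I\<close> \<open>k \<in> parking I\<close> by simp
  qed
  have flow: "m i \<le> (\<Sum>k\<in>U - {i}. v k i) - (\<Sum>k\<in>U - {i}. v i k)" if i: "i \<in> U" for i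
  proof -
    have "m i = (\<Sum>k\<in>stops I - {i}. v k i) - (\<Sum>k\<in>stops I - {depot I, i}. v i k)"
      using feas i U unfolding cdpp_feasible_def m_def by auto
    moreover have "(\<Sum>k\<in>stops I - {i}. v k i) = (\<Sum>k\<in>U - {i}. v k i)"
      using i U into finite_sets by (intro sum.mono_neutral_right) auto
    moreover have "(\<Sum>k\<in>U - {i}. v i k) \<le> (\<Sum>k\<in>stops I - {depot I, i}. v i k)"
      using i U v0 finite_sets by (intro sum_mono2) (auto simp: parking_def)
    ultimately show ?thesis by linarith
  qed
  have "(\<Sum>i\<in>U. m i) \<le> (\<Sum>i\<in>U. \<Sum>k\<in>U - {i}. v k i) - (\<Sum>i\<in>U. \<Sum>k\<in>U - {i}. v i k)"
    using sum_mono[of U m, OF flow] by (simp add: sum_subtractf)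
  also have "(\<Sum>i\<in>U. \<Sum>k\<in>U - {i}. v k i) = (\<Sum>i\<in>U. \<Sum>k\<in>U - {i}. v i k)"
  proof -
    have "(\<Sum>i\<in>U. \<Sum>k\<in>{k \<in> U. k \<noteq> i}. v k i) = (\<Sum>k\<in>U. \<Sum>i\<in>{i \<in> U. k \<noteq> i}. v k i)"
      by (rule sum.swap_restrict) (use U in auto)
    moreover have "{k \<in> U. k \<noteq> i} = U - {i}" "{k \<in> U. i \<noteq> k} = U - {i}" for i by auto
    ultimately show ?thesis by simp
  qed
  finally have "(\<Sum>i\<in>U. m i) \<le> 0" by simp
  moreover have m0: "0 \<le> m i" if "i \<in> U" for i
    unfolding m_def using that U y01 by (intro sum_nonneg) fastforce
  ultimately have "m k \<le> 0"
    using member_le_sum[of k U m] k U by force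
  moreover have "int (card \<sigma>) * y k \<sigma> \<le> m k"
    unfolding m_def using assms(2) y01 finite_sets k U
    by (intro member_le_sum) (fastforce simp: assigned_def)+
  moreover have "card \<sigma> > 0"
    using assms(2) finite_sets by (auto simp: assigned_def service_sets_def card_gt_0_iff intro: finite_subset)
  ultimately show False using assms(2) by (simp add: assigned_def)
qed

lemma feasible_tour:
  assumes feas: "cdpp_feasible I x y v"
  obtains ts where "distinct ts" "set ts = fst ` assigned I y"
    "path_length (drive_cost I) (depot I # ts @ [depot I]) \<le>
      (\<Sum>(i, k)\<in>driven I x. drive_cost I i k)"
proof -
  let ?r = "depot I" and ?E = "driven I x" and ?T = "fst ` assigned I y"
  obtain vs where vs: "trail ?E ?r vs ?r" and reach: "?E\<^sup>* `` {?r} \<subseteq> set vs"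
    using balanced_trail_reaches[OF finite_driven feasible_balanced[OF feas]] by blast
  have r: "?r \<in> stops I" using inst by (simp add: cdpp_instance_def)
  have T: "?T \<subseteq> set vs" "?T \<subseteq> parking I"
    using reach feasible_reachable[OF feas] by (fastforce simp: assigned_def)+
  then have rT: "?r \<notin> ?T" by (auto simp: parking_def)
  have "?T \<noteq> {}"
  proof -
    obtain i where "i \<in> customers I" using inst by (auto simp: cdpp_instance_def)
    then have "card {p \<in> assigned I y. i \<in> snd p} = 1"
      using feasible_exact_cover[OF feas] by (simp add: exact_cover_def)
    then show ?thesis by fastforce
  qed
  then obtain t where "t \<in> ?T" by (meson ex_in_conv)
  with T(1) rT have t: "t \<in> set vs" "t \<noteq> ?r" by (blast, metis)
  obtain vs1 where vs1: "vs = ?r # vs1" using vs by (cases vs) (auto simp: trail_def)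
  have ne: "vs1 \<noteq> []" using t by (auto simp: vs1)
  moreover have "last vs1 = ?r" using vs ne by (simp add: trail_def vs1)
  moreover define mid where "mid = butlast vs1"
  ultimately have mid: "vs = ?r # mid @ [?r]"
    using append_butlast_last_id[OF ne] by (simp add: vs1)
  have "set vs \<subseteq> stops I"
  proof -
    have "snd ` set (steps vs) \<subseteq> stops I" using vs by (auto simp: trail_def driven_def)
    moreover have "set vs \<subseteq> insert ?r (snd ` set (steps vs))"
      using set_steps[of vs] vs by (simp add: trail_def)
    ultimately show ?thesis using r by (meson insert_subset subset_trans)
  qed
  then have mid_stops: "set mid \<subseteq> stops I" by (simp add: mid)
  define ts where "ts = remdups (filter (\<lambda>k. k \<in> ?T) mid)"
  have "subseq ts mid"
    unfolding ts_def by (rule subseq_order.order_trans[OF subseq_remdups subseq_filter_left])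
  then have "path_length (drive_cost I) (?r # ts @ [?r]) \<le> path_length (drive_cost I) vs"
    unfolding mid using r mid_stops drive_cost_triangle
    by (intro path_length_subseq[where V = "stops I"]) auto
  also have "\<dots> = (\<Sum>(i, k)\<in>set (steps vs). drive_cost I i k)"
    using vs by (simp add: path_length_distinct trail_def)
  also have "\<dots> \<le> (\<Sum>(i, k)\<in>?E. drive_cost I i k)"
    using vs finite_driven drive_cost_nonneg
    by (intro sum_mono2) (auto simp: trail_def driven_def)
  finally have "path_length (drive_cost I) (?r # ts @ [?r]) \<le> (\<Sum>(i, k)\<in>?E. drive_cost I i k)" .
  moreover have "set ts = ?T"
  proof -
    have "?T \<subseteq> insert ?r (set mid)" using T(1) by (simp add: mid)
    then have "?T \<subseteq> set mid" by (simp only: subset_insert[OF rT])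
    then show ?thesis by (auto simp: ts_def)
  qed
  moreover have "distinct ts" by (simp add: ts_def)
  ultimately show ?thesis using that by blast
qed

text \<open>
  The new assignment is the image of the old one under removal of \<open>T\<close>, together with the free
  walks at the elements of \<open>T\<close>. Sets contained in \<open>T\<close> must be dropped, as a service set is
  nonempty.
\<close>

lemma reassign_own:
  assumes A: "A \<subseteq> parking I \<times> service_sets I" "exact_cover (customers I) A"
    and T: "T \<subseteq> parking I \<inter> customers I"
  defines "B \<equiv> (\<lambda>(k, \<sigma>). (k, \<sigma> - T)) ` {p \<in> A. \<not> snd p \<subseteq> T} \<union> (\<lambda>k. (k, {k})) ` T"
  shows "exact_cover (customers I) B"
    and "(\<Sum>(k, \<sigma>)\<in>B. service_walk I k \<sigma>) \<le> (\<Sum>(k, \<sigma>)\<in>A. service_walk I k \<sigma>)"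
proof -
  let ?A = "{p \<in> A. \<not> snd p \<subseteq> T}" and ?cut = "\<lambda>p. (fst p, snd p - T)"
  have B: "B = ?cut ` ?A \<union> (\<lambda>k. (k, {k})) ` T"
    by (simp add: B_def case_prod_unfold)
  show "exact_cover (customers I) B"
    unfolding exact_cover_def
  proof
    fix i assume i: "i \<in> customers I"
    show "card {p \<in> B. i \<in> snd p} = 1"
    proof (cases "i \<in> T")
      case True
      then have "{p \<in> B. i \<in> snd p} = {(i, {i})}" by (auto simp: B)
      then show ?thesis by simp
    next
      case False
      have "card {p \<in> A. i \<in> snd p} = 1" using A(2) i by (simp add: exact_cover_def)
      then obtain p where p: "{p \<in> A. i \<in> snd p} = {p}" by (rule card_1_singletonE)
      have "{p \<in> B. i \<in> snd p} = ?cut ` {p \<in> A. i \<in> snd p}" using False by (auto simp: B)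
      then show ?thesis by (simp add: p)
    qed
  qed
  have finA: "finite A" using A(1) finite_sets by (meson finite_SigmaI finite_subset)
  have finT: "finite T" using T finite_sets by (meson finite_Int finite_subset)
  have w: "0 \<le> service_walk I (fst p) (snd p - T)"
    "service_walk I (fst p) (snd p - T) \<le> service_walk I (fst p) (snd p)"
    "0 \<le> service_walk I (fst p) (snd p)" if "p \<in> A" for p
  proof -
    have "fst p \<in> parking I" "snd p \<in> service_sets I" using that A(1) by auto
    then have "fst p \<in> parking I" "snd p \<subseteq> customers I" by (simp_all add: service_sets_def)
    then show "0 \<le> service_walk I (fst p) (snd p - T)"
      "service_walk I (fst p) (snd p - T) \<le> service_walk I (fst p) (snd p)"
      "0 \<le> service_walk I (fst p) (snd p)"
      by (auto intro!: service_walk_nonneg service_walk_mono)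
  qed
  let ?w = "\<lambda>p. service_walk I (fst p) (snd p)"
  have "sum ?w B = sum ?w (?cut ` ?A) + sum ?w ((\<lambda>k. (k, {k})) ` T)"
    unfolding B using finA finT by (intro sum.union_disjoint) auto
  also have "sum ?w ((\<lambda>k. (k, {k})) ` T) = 0"
    using T service_walk_own by (intro sum.neutral) auto
  also have "sum ?w (?cut ` ?A) \<le> sum (?w \<circ> ?cut) ?A"
    using finA w by (intro sum_image_le) auto
  also have "\<dots> \<le> sum ?w ?A" using w by (intro sum_mono) auto
  also have "\<dots> \<le> sum ?w A" using finA w by (intro sum_mono2) auto
  finally show "(\<Sum>(k, \<sigma>)\<in>B. service_walk I k \<sigma>) \<le> (\<Sum>(k, \<sigma>)\<in>A. service_walk I k \<sigma>)"
    by (simp add: case_prod_unfold)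
qed

lemma feasible_plan:
  assumes feas: "cdpp_feasible I x y v"
    and load: "\<And>\<sigma>. \<sigma> \<in> service_sets I \<Longrightarrow> load_time I \<sigma> = f * real (card \<sigma>)"
  obtains ts A where "plan I ts A"
    "plan_cost I ts A + f * real (card (customers I)) \<le> cdpp_cost I x y"
proof -
  obtain ts where ts: "distinct ts" "set ts = fst ` assigned I y"
    and drive: "path_length (drive_cost I) (depot I # ts @ [depot I]) \<le>
      (\<Sum>(i, k)\<in>driven I x. drive_cost I i k)"
    using feasible_tour[OF feas] by blast
  define T where "T = set ts \<inter> customers I"
  define B where "B = (\<lambda>(k, \<sigma>). (k, \<sigma> - T)) ` {p \<in> assigned I y. \<not> snd p \<subseteq> T} \<union> (\<lambda>k. (k, {k})) ` T"
  have sub: "assigned I y \<subseteq> parking I \<times> service_sets I" by (auto simp: assigned_def)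
  then have parking: "set ts \<subseteq> parking I" using ts(2) by auto
  then have T: "T \<subseteq> parking I \<inter> customers I" by (auto simp: T_def)
  note reassigned = reassign_own[OF sub feasible_exact_cover[OF feas] T, folded B_def]
  have "B \<subseteq> set ts \<times> service_sets I"
  proof
    fix p assume "p \<in> B"
    then have "(\<exists>q\<in>assigned I y. \<not> snd q \<subseteq> T \<and> p = (fst q, snd q - T)) \<or> (\<exists>k\<in>T. p = (k, {k}))"
      unfolding B_def case_prod_unfold by blast
    then show "p \<in> set ts \<times> service_sets I"
    proof (elim disjE bexE conjE)
      fix q assume q: "q \<in> assigned I y" "\<not> snd q \<subseteq> T" "p = (fst q, snd q - T)"
      then have "snd q \<in> service_sets I" by (auto simp: assigned_def)
      then have "snd q - T \<in> service_sets I"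
        by (rule service_sets_subset[OF _ Diff_subset]) (use q(2) in auto)
      then show ?thesis using q ts(2) by simp
    next
      fix k assume "k \<in> T" "p = (k, {k})"
      then show ?thesis using singleton_service_set by (auto simp: T_def)
    qed
  qed
  then have "plan I ts B"
    using ts(1) parking reassigned(1) by (auto simp: plan_def B_def T_def)
  moreover have "plan_cost I ts B + f * real (card (customers I)) \<le> cdpp_cost I x y"
    using feasible_cost[OF feas load] drive reassigned(2) by (simp add: plan_cost_def)
  ultimately show ?thesis using that by blast
qed

subsection \<open>From plans to feasible solutions\<close>

lemma plan_feasible:
  assumes plan: "plan I ts A"
    and load: "\<And>\<sigma>. \<sigma> \<in> service_sets I \<Longrightarrow> load_time I \<sigma> = f * real (card \<sigma>)"
  obtains x y v where "cdpp_feasible I x y v"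
    "cdpp_cost I x y = plan_cost I ts A + f * real (card (customers I))"
    "\<And>i. i \<in> parking I \<Longrightarrow> (\<Sum>k\<in>stops I - {i}. x k i) = of_bool (i \<in> set ts)"
    "\<And>i \<sigma>. y i \<sigma> = of_bool ((i, \<sigma>) \<in> A)"
proof -
  define r where "r = depot I"
  define n where "n = int (card (customers I))"
  define E where "E = set (steps (r # ts @ [r]))"
  define x :: "'a \<Rightarrow> 'a \<Rightarrow> int" where "x i k = of_bool ((i, k) \<in> E)" for i k
  define y :: "'a \<Rightarrow> 'a set \<Rightarrow> int" where "y i \<sigma> = of_bool ((i, \<sigma>) \<in> A)" for i \<sigma>
  define m where "m i = (\<Sum>\<sigma>\<in>service_sets I. int (card \<sigma>) * y i \<sigma>)" for i
  \<comment> \<open>The vehicle enters \<open>k\<close> with what is still to be delivered from \<open>k\<close> onwards. For the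
    depot \<open>dropWhile\<close> leaves nothing, so \<open>g\<close> vanishes there, as it must on the way home.\<close>
  define g where "g k = (\<Sum>t\<in>set (dropWhile (\<lambda>t. t \<noteq> k) ts). m t)" for k
  define v :: "'a \<Rightarrow> 'a \<Rightarrow> int" where "v i k = (if (i, k) \<in> E then g k else 0)" for i k
  have ts: "distinct ts" "set ts \<subseteq> parking I" and A: "A \<subseteq> set ts \<times> service_sets I"
    and cover: "exact_cover (customers I) A"
    using plan by (auto simp: plan_def)
  have parking: "parking I = stops I - {r}" and r: "r \<in> stops I"
    using inst by (auto simp: parking_def r_def cdpp_instance_def)
  have dist: "distinct (r # ts)" using ts by (auto simp: parking)
  have finA: "finite A" using A finite_sets by (meson finite_SigmaI finite_set finite_subset)
  have assigned: "assigned I y = A" using A ts(2) by (auto simp: assigned_def y_def)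
  have served: "snd p \<subseteq> customers I" if "p \<in> A" for p
  proof -
    have "snd p \<in> service_sets I" using that A by auto
    then show ?thesis by (simp add: service_sets_def)
  qed
  have ts_ne: "ts \<noteq> []"
  proof
    assume "ts = []"
    then have "A = {}" using A by simp
    then show False using cover inst by (auto simp: exact_cover_def cdpp_instance_def)
  qed
  have E_tour: "i \<in> insert r (set ts) \<and> k \<in> insert r (set ts)" if "(i, k) \<in> E" for i k
    using steps_in_set[of i k "r # ts @ [r]"] that by (auto simp: E_def)
  have tour_stops: "insert r (set ts) \<subseteq> stops I" using ts r by (auto simp: parking)
  have ends: "(r, k) \<in> E \<longleftrightarrow> k = hd ts" "(k, r) \<in> E \<longleftrightarrow> k = last ts" for k
    unfolding E_def using tour_ends[OF dist ts_ne] by auto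
  have neighbours: "\<exists>p q. p \<in> stops I - {i} \<and> q \<in> stops I - {i} \<and>
      (\<forall>k. (k, i) \<in> E \<longleftrightarrow> k = p) \<and> (\<forall>k. (i, k) \<in> E \<longleftrightarrow> k = q) \<and> g i = m i + g q"
    if "i \<in> set ts" for i
  proof -
    obtain as bs where split: "ts = as @ i # bs" using \<open>i \<in> set ts\<close> by (meson split_list)
    let ?p = "last (r # as)" and ?q = "hd (bs @ [r])"
    have d: "distinct (r # as @ i # bs)" using dist by (simp add: split)
    have "?p \<in> set (r # as)" "?q \<in> set (bs @ [r])"
      by (rule last_in_set, simp) (rule hd_in_set, simp)
    then have "?p \<in> stops I - {i}" "?q \<in> stops I - {i}"
      using d tour_stops split by auto
    moreover have "(k, i) \<in> E \<longleftrightarrow> k = ?p" "(i, k) \<in> E \<longleftrightarrow> k = ?q" for k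
      unfolding E_def split using tour_neighbours[OF d] by auto
    moreover have "g i = m i + g ?q"
    proof -
      have i: "dropWhile (\<lambda>t. t \<noteq> i) ts = i # bs"
        using d unfolding split by (subst dropWhile_append2) auto
      have q: "dropWhile (\<lambda>t. t \<noteq> ?q) ts = bs"
      proof (cases bs)
        case Nil
        then show ?thesis using d by (auto simp: split)
      next
        case (Cons b bs')
        then show ?thesis using d unfolding split by (subst dropWhile_append2) auto
      qed
      show ?thesis using d by (simp add: g_def i q)
    qed
    ultimately show ?thesis by blast
  qed
  have off: "(k, i) \<notin> E" "(i, k) \<notin> E" if "i \<in> parking I" "i \<notin> set ts" for i k
    using E_tour that by (auto simp: parking)
  have loopless: "i \<noteq> k" if "(i, k) \<in> E" for i k
  proof
    assume "i = k"
    moreover have "hd ts \<noteq> r" using dist ts_ne by auto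
    ultimately show False using E_tour[OF that] neighbours[of i] ends(1) that by auto
  qed
  have m0: "0 \<le> m i" for i unfolding m_def y_def by (intro sum_nonneg) simp
  have g0: "0 \<le> g k" for k unfolding g_def by (intro sum_nonneg m0)
  have m_sum: "m i = (\<Sum>\<sigma>\<in>{\<sigma>. (i, \<sigma>) \<in> A}. int (card \<sigma>))" for i
    unfolding m_def y_def using A finite_sets
    by (intro sum.mono_neutral_cong_right) auto
  have total: "(\<Sum>t\<in>set ts. m t) = n"
  proof -
    have slice: "finite {\<sigma>. (t, \<sigma>) \<in> A}" for t
      by (rule finite_subset[of _ "snd ` A"]) (use finA in force)+
    have "(\<Sum>t\<in>set ts. m t) = (\<Sum>p\<in>Sigma (set ts) (\<lambda>t. {\<sigma>. (t, \<sigma>) \<in> A}). int (card (snd p)))"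
      unfolding m_sum by (subst sum.Sigma) (auto simp: case_prod_unfold slice)
    also have "Sigma (set ts) (\<lambda>t. {\<sigma>. (t, \<sigma>) \<in> A}) = A" using A by auto
    also have "(\<Sum>p\<in>A. int (card (snd p))) = n"
      unfolding n_def of_nat_sum[symmetric] of_nat_eq_iff
      by (intro exact_cover_sum_card finite_sets finA cover served)
    finally show ?thesis .
  qed
  have gn: "g k \<le> n" for k
    unfolding g_def total[symmetric] by (intro sum_mono2 m0) (auto dest: set_dropWhileD)
  have in_degree: "(\<Sum>k\<in>stops I - {i}. x k i) = of_bool (i \<in> set ts)"
    and out_degree: "(\<Sum>k\<in>stops I - {i}. x i k) = of_bool (i \<in> set ts)"
    if "i \<in> parking I" for i
  proof -
    have "(\<Sum>k\<in>stops I - {i}. x k i) = of_bool (i \<in> set ts) \<and>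
        (\<Sum>k\<in>stops I - {i}. x i k) = of_bool (i \<in> set ts)"
    proof (cases "i \<in> set ts")
      case True
      then obtain p q where "p \<in> stops I - {i}" "q \<in> stops I - {i}"
        "\<forall>k. (k, i) \<in> E \<longleftrightarrow> k = p" "\<forall>k. (i, k) \<in> E \<longleftrightarrow> k = q"
        using neighbours by blast
      then show ?thesis using True finite_sets by (simp add: x_def of_bool_def sum.delta)
    next
      case False
      then show ?thesis using off that by (simp add: x_def)
    qed
    then show "(\<Sum>k\<in>stops I - {i}. x k i) = of_bool (i \<in> set ts)"
      "(\<Sum>k\<in>stops I - {i}. x i k) = of_bool (i \<in> set ts)" by auto
  qed
  have hl: "hd ts \<in> parking I" "last ts \<in> parking I" using ts ts_ne by auto
  have "(\<Sum>i\<in>parking I. x r i) = 1" "(\<Sum>i\<in>parking I. x i r) = 1"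
    using hl finite_sets by (simp_all add: x_def ends of_bool_def sum.delta)
  moreover have "(\<Sum>k\<in>parking I. \<Sum>\<sigma>\<in>service_sets_of I i. y k \<sigma>) = 1" if "i \<in> customers I" for i
    using sum_service_sets_of[of y i] cover that
    by (simp add: assigned exact_cover_def) (simp add: y_def)
  moreover have "(\<Sum>k\<in>stops I - {i}. x k i) = (\<Sum>k\<in>stops I - {i}. x i k)" if "i \<in> parking I" for i
    using in_degree out_degree that by simp
  moreover have "y i \<sigma> \<le> (\<Sum>k\<in>stops I - {i}. x k i)" if "i \<in> parking I" for i \<sigma>
    using A in_degree[OF that] by (auto simp: y_def)
  moreover have "(\<Sum>i\<in>parking I. v r i) = n"
  proof -
    have "(\<Sum>i\<in>parking I. v r i) = g (hd ts)"
      using hl finite_sets by (simp add: v_def ends sum.delta)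
    also have "\<dots> = n" using ts_ne by (cases ts) (simp_all add: g_def flip: total)
    finally show ?thesis .
  qed
  moreover have "v i k \<le> n * x i k" for i k using gn by (simp add: v_def x_def)
  moreover have "(\<Sum>k\<in>stops I - {i}. v k i) - (\<Sum>k\<in>stops I - {r, i}. v i k) = m i"
    if "i \<in> parking I" for i
  proof -
    have "dropWhile (\<lambda>t. t \<noteq> r) ts = []" using dist by (auto simp: dropWhile_eq_Nil_conv)
    then have "g r = 0" by (simp only: g_def list.set sum.empty)
    then have "v i r = 0" by (simp add: v_def)
    then have "(\<Sum>k\<in>stops I - {r, i}. v i k) = (\<Sum>k\<in>stops I - {i}. v i k)"
      using finite_sets by (intro sum.mono_neutral_left) auto
    moreover have "(\<Sum>k\<in>stops I - {i}. v k i) - (\<Sum>k\<in>stops I - {i}. v i k) = m i"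
    proof (cases "i \<in> set ts")
      case True
      then obtain p q where "p \<in> stops I - {i}" "q \<in> stops I - {i}"
        "\<forall>k. (k, i) \<in> E \<longleftrightarrow> k = p" "\<forall>k. (i, k) \<in> E \<longleftrightarrow> k = q" "g i = m i + g q"
        using neighbours by blast
      then show ?thesis using finite_sets by (simp add: v_def sum.delta)
    next
      case False
      moreover from False have "m i = 0" using A unfolding m_sum by (intro sum.neutral) auto
      ultimately show ?thesis using off that by (simp add: v_def)
    qed
    ultimately show ?thesis by simp
  qed
  moreover have "x i k \<in> {0, 1}" "y i \<sigma> \<in> {0, 1}" "0 \<le> v i k" for i k \<sigma>
    using g0 by (simp_all add: x_def y_def v_def)
  ultimately have feas: "cdpp_feasible I x y v"
    unfolding cdpp_feasible_def r_def[symmetric] n_def[symmetric] m_def by blast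
  have "i \<in> stops I \<and> k \<in> stops I - {i}" if "(i, k) \<in> E" for i k
    using E_tour[OF that] loopless[OF that] tour_stops by blast
  then have "driven I x = E"
    by (auto simp: driven_def x_def)
  moreover have "distinct (steps (r # ts @ [r]))"
    unfolding steps_closed by (rule distinct_zipI1[OF dist])
  ultimately have "cdpp_cost I x y = plan_cost I ts A + f * real (card (customers I))"
    using feasible_cost[OF feas load]
    by (simp add: assigned plan_cost_def path_length_distinct E_def flip: r_def)
  from feas this in_degree show ?thesis by (rule that) (simp_all add: y_def)
qed

lemma optimal_plan:
  obtains ts A where "plan I ts A" "\<And>ts' A'. plan I ts' A' \<Longrightarrow> plan_cost I ts A \<le> plan_cost I ts' A'"
proof -
  let ?P = "{(ts, A). plan I ts A}"
  have "?P \<subseteq> {ts. set ts \<subseteq> parking I \<and> distinct ts} \<times> Pow (parking I \<times> service_sets I)"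
    by (auto simp: plan_def)
  then have fin: "finite ?P"
    by (rule finite_subset) (use finite_sets in \<open>auto intro: finite_subset_distinct\<close>)
  obtain p where p: "p \<in> parking I" using inst by (auto simp: cdpp_instance_def)
  have "exact_cover (customers I) ((\<lambda>i. (p, {i})) ` customers I)"
    unfolding exact_cover_def
  proof
    fix i assume "i \<in> customers I"
    then have "{q \<in> (\<lambda>i. (p, {i})) ` customers I. i \<in> snd q} = {(p, {i})}" by auto
    then show "card {q \<in> (\<lambda>i. (p, {i})) ` customers I. i \<in> snd q} = 1" by simp
  qed
  then have "plan I [p] ((\<lambda>i. (p, {i})) ` customers I)"
    using p singleton_service_set by (auto simp: plan_def)
  then have "?P \<noteq> {}" by auto
  then obtain q where "is_arg_min (\<lambda>(ts, A). plan_cost I ts A) (\<lambda>q. q \<in> ?P) q"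
    using ex_is_arg_min_if_finite[OF fin] by blast
  then show ?thesis using that[of "fst q" "snd q"] by (force simp: is_arg_min_linorder)
qed

end

theorem claim4:
  fixes I :: "'a cdpp" and f :: real
  assumes "cdpp_instance I"
    and "0 \<le> f"
    and "\<And>\<sigma>. \<sigma> \<in> service_sets I \<Longrightarrow> load_time I \<sigma> = f * real (card \<sigma>)"
  shows "\<exists>x y v. cdpp_optimal I x y v \<and>
    (\<forall>i \<in> stops I \<inter> customers I. (\<exists>k \<in> stops I - {i}. x k i = 1) \<longrightarrow> y i {i} = 1) \<and>
    (\<forall>i \<in> stops I \<inter> customers I. (\<Sum>k \<in> stops I - {i}. x k i) = y i {i})"
proof -
  obtain ts A where plan: "plan I ts A"
    and least: "\<And>ts' A'. plan I ts' A' \<Longrightarrow> plan_cost I ts A \<le> plan_cost I ts' A'"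
    using optimal_plan[OF assms(1)] by blast
  obtain x y v where feas: "cdpp_feasible I x y v"
    and cost: "cdpp_cost I x y = plan_cost I ts A + f * real (card (customers I))"
    and degree: "\<And>i. i \<in> parking I \<Longrightarrow> (\<Sum>k\<in>stops I - {i}. x k i) = of_bool (i \<in> set ts)"
    and y: "\<And>i \<sigma>. y i \<sigma> = of_bool ((i, \<sigma>) \<in> A)"
    using plan_feasible[OF assms(1) plan assms(3)] by blast
  have "cdpp_cost I x y \<le> cdpp_cost I x' y'" if feas': "cdpp_feasible I x' y' v'" for x' y' v'
  proof -
    obtain ts' A' where "plan I ts' A'"
      "plan_cost I ts' A' + f * real (card (customers I)) \<le> cdpp_cost I x' y'"
      using feasible_plan[OF assms(1) feas' assms(3)] by blast
    then show ?thesis using least[of ts' A'] cost by simp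
  qed
  then have "cdpp_optimal I x y v" using feas by (simp add: cdpp_optimal_def)
  moreover have own: "(\<Sum>k\<in>stops I - {i}. x k i) = y i {i}" if "i \<in> stops I \<inter> customers I" for i
  proof -
    have "i \<in> parking I" using that assms(1) by (auto simp: parking_def cdpp_instance_def)
    moreover have "i \<in> set ts \<longleftrightarrow> (i, {i}) \<in> A" using plan that by (auto simp: plan_def)
    ultimately show ?thesis using degree y by simp
  qed
  moreover have "y i {i} = 1" if "i \<in> stops I \<inter> customers I" "k \<in> stops I - {i}" "x k i = 1" for i k
  proof -
    have "x l i \<ge> 0" if "l \<in> stops I - {i}" for l
      using feasible_binary(1)[OF assms(1) feas, of l i] that \<open>i \<in> stops I \<inter> customers I\<close> by auto
    then have "x k i \<le> (\<Sum>k\<in>stops I - {i}. x k i)"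
      using that finite_sets[OF assms(1)] by (intro member_le_sum) auto
    then show ?thesis using own[OF that(1)] that(3) y[of i "{i}"] by (auto simp: of_bool_def split: if_splits)
  qed
  ultimately show ?thesis by blast
qed

end
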